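(* Let $m \ge 1$ and $r > 2$ be integers and let $a = (a_1,\ldots,a_m) \in \mathbf{Z}^m$. If $a$ is hereditarily good mod $r$, then for every integer $t \ge 1$ the finite cyclic groups $\mathrm{LMR}(r,t,a)$ and $\mathrm{LMR}(r,t,-a)$ are Hodge-equivalent, i.e. $\Lambda_{\mathrm{LMR}(r,t,a)}(x,y) = \Lambda_{\mathrm{LMR}(r,t,-a)}(x,y)$.
   Context: Hodge series: for a finite group $G \subset U_n$ of $n\times n$ unitary complex matrices, the Hodge series of $G$ is the rational function (equivalently, formal power series) in $x,y$ $$\Lambda_G(x,y) = \frac{1}{|G|}\sum_{g\in G} \frac{\det(I_n + y g)}{\det(I_n - x g)}.$$ Two finite groups $G,H\subset U_n$ are Hodge-equivalent if $\Lambda_G = \Lambda_H$. The groups: for a positive integer $q$ write $\omega_q = \exp(2\pi i/q)$. For $s = (s_1,\ldots,s_n)\in\mathbf{Z}^n$, let $L(q,s) = \{\mathrm{diag}(\omega_q^{k s_1},\ldots,\omega_q^{k s_n}) : k \in \mathbf{Z}/q\mathbf{Z}\} \subset U_n$, the cyclic group generated by $\mathrm{diag}(\omega_q^{s_1},\ldots,\omega_q^{s_n})$. For integers $r>2$, $t\ge 1$ and $a=(a_1,\ldots,a_m)\in\mathbf{Z}^m$, define $$\mathrm{LMR}(r,t,a) = L\bigl(r^2t,\ (rta_1+1,\,-(rta_1+1),\ \ldots,\ rta_m+1,\,-(rta_m+1))\bigr) \subset U_{2m}.$$ Here $-a = (-a_1,\ldots,-a_m)$. Goodness: let $d\ge 1$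 be an integer and $a = (a_1,\ldots,a_m) \in \mathbf{Z}^m$. - $a$ is univalent mod $d$ if its entries $a_1,\ldots,a_m$ are pairwise distinct mod $d$. - $a$ is reversible mod $d$ if there is an integer $c$ such that $(a_1+c,\ldots,a_m+c)$ and $(-a_1,\ldots,-a_m)$ are equal as multisets of residues mod $d$. - $a$ is good mod $d$ if it is univalent mod $d$ or reversible mod $d$. - $a$ is hereditarily good mod $r$ if it is good mod $d$ for every positive divisor $d$ of $r$. *)

theory Defs
  imports
    "Jordan_Normal_Form.Determinant"
    "Jordan_Normal_Form.Schur_Decomposition"
begin

definition unitary_group :: "nat \<Rightarrow> complex mat monoid" where
  "unitary_group n =
    \<lparr>carrier = {U \<in> carrier_mat n n. mat_adjoint U * U = 1\<^sub>m n}, monoid.mult = (*), one = 1\<^sub>m n\<rparr>"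

text \<open>
  Bivariate polynomials in \<open>x\<close>, \<open>y\<close> are polynomials in \<open>y\<close> (the outer variable) over the
  polynomials in \<open>x\<close> (the inner variable); rational functions form their fraction field.
\<close>

definition var_x :: "complex poly poly" where "var_x = [:[:0, 1:]:]"

definition var_y :: "complex poly poly" where "var_y = [:0, 1:]"

definition const_mat :: "complex mat \<Rightarrow> complex poly poly mat" where
  "const_mat g = map_mat (\<lambda>c. [:[:c:]:]) g"

text \<open>
  The denominators below never vanish: \<open>det (1 - x g)\<close> is \<open>1\<close> at \<open>x = 0\<close>.
\<close>

definition hodge_series :: "nat \<Rightarrow> complex mat set \<Rightarrow> complex poly poly fract" where
  "hodge_series n G =
     1 / of_nat (card G) *
       (\<Sum>g\<in>G. to_fract (det (1\<^sub>m n + var_y \<cdot>\<^sub>m const_mat g)) /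
               to_fract (det (1\<^sub>m n - var_x \<cdot>\<^sub>m const_mat g)))"

definition hodge_equivalent :: "nat \<Rightarrow> complex mat set \<Rightarrow> complex mat set \<Rightarrow> bool" where
  "hodge_equivalent n G H \<longleftrightarrow>
     finite G \<and> subgroup G (unitary_group n) \<and>
     finite H \<and> subgroup H (unitary_group n) \<and>
     hodge_series n G = hodge_series n H"

definition root_of_unity :: "nat \<Rightarrow> complex" where
  "root_of_unity q = exp (2 * of_real pi * \<i> / of_nat q)"

definition L :: "nat \<Rightarrow> int list \<Rightarrow> complex mat set" where
  "L q s = (\<lambda>k. mat_diag (length s) (\<lambda>i. root_of_unity q powi (int k * s ! i))) ` {0..<q}"

definition LMR :: "nat \<Rightarrow> nat \<Rightarrow> int list \<Rightarrow> complex mat set" where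
  "LMR r t a =
     L (r\<^sup>2 * t)
       (concat (map (\<lambda>c. [int r * int t * c + 1, - (int r * int t * c + 1)]) a))"

definition univalent :: "int list \<Rightarrow> nat \<Rightarrow> bool" where
  "univalent a d \<longleftrightarrow> distinct (map (\<lambda>x. x mod int d) a)"

definition reversible :: "int list \<Rightarrow> nat \<Rightarrow> bool" where
  "reversible a d \<longleftrightarrow>
     (\<exists>c::int. mset (map (\<lambda>x. (x + c) mod int d) a) = mset (map (\<lambda>x. (- x) mod int d) a))"

definition good :: "int list \<Rightarrow> nat \<Rightarrow> bool" where
  "good a d \<longleftrightarrow> univalent a d \<or> reversible a d"

definition hereditarily_good :: "int list \<Rightarrow> nat \<Rightarrow> bool" where
  "hereditarily_good a r \<longleftrightarrow> (\<forall>d. d > 0 \<longrightarrow> d dvd r \<longrightarrow> good a d)"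

end

theory Submission
  imports Defs
begin

text \<open>
  Put \<open>N = r t\<close>, so that the group has order \<open>q = r N\<close>, and index its elements by the \<open>q\<close>-th roots of
  unity \<open>\<theta>\<close> instead of by exponents. The eigenvalues of the element \<open>\<theta>\<close> are
  \<open>\<theta>\<^bsup>Nc+1\<^esup> = \<theta> \<cdot> (\<theta>\<^sup>N)\<^bsup>c\<^esup>\<close> and their inverses, for \<open>c\<close> in \<open>a\<close>. With
  \<open>\<phi>(w) = (1 + y w) (1 + y/w) / ((1 - x w) (1 - x/w))\<close>, the element contributes
  \<open>\<Prod>\<^sub>c \<phi>(\<theta> u\<^sup>c)\<close> to the Hodge series, where \<open>u = \<theta>\<^sup>N\<close> is an \<open>r\<close>-th root of unity. So the sum is
  split over \<open>u\<close>, and for each \<open>u\<close> the sums over the coset \<open>\<theta>\<^sup>N = u\<close> for \<open>a\<close> and for \<open>-a\<close> are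
  shown to agree. Only the residues of \<open>a\<close> modulo the order \<open>d\<close> of \<open>u\<close> matter, and \<open>d\<close> divides \<open>r\<close>,
  which is why goodness modulo every divisor is the right hypothesis.

  If \<open>a\<close> is reversible mod \<open>d\<close> with shift \<open>e\<close>, the substitution \<open>\<theta> \<mapsto> \<theta> u\<^sup>e\<close>, which permutes the coset
  because \<open>r\<close> divides \<open>N\<close>, carries one sum to the other.

  If \<open>a\<close> is univalent mod \<open>d\<close>, then \<open>\<phi>(1/w) = \<phi>(w)\<close> turns the sum for \<open>-a\<close> over \<open>\<theta>\<^sup>N = u\<close> into the sum
  for \<open>a\<close> over \<open>\<theta>\<^sup>N = 1/u\<close>, with the same summand \<open>R(\<theta>) = \<Prod>\<^sub>z \<phi>(\<theta> z)\<close>, \<open>z\<close> ranging over the distinct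
  powers \<open>u\<^sup>c\<close>. As a rational function of \<open>\<theta>\<close>, \<open>R\<close> has only simple poles, namely \<open>x/z\<close> and
  \<open>1/(x z)\<close>, and takes the same value at \<open>0\<close> and at infinity. Write \<open>R = C + \<Sum>\<^sub>p c\<^sub>p / (\<theta> - p)\<close>; then
  \<open>\<Sum>\<^sub>p c\<^sub>p / p = 0\<close>. The sum of \<open>1 / (\<theta> - p)\<close> over the coset depends on \<open>p\<close> only through the factor
  \<open>1/p\<close> and through \<open>p\<^sup>N\<close>, which is \<open>X = x\<^sup>N\<close> for the first kind of pole and \<open>1/X\<close> for the second. Hence
  the sum of \<open>R\<close> over the coset is \<open>N C + N S (X / (u - X) - 1 / (u X - 1))\<close> with \<open>S\<close> the sum of the
  \<open>c\<^sub>p / p\<close> over the first kind. This expression is invariant under \<open>u \<mapsto> 1/u\<close>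
  (\<open>sum_factor_prod_inverse_coset\<close>).
\<close>

section \<open>Sums over roots of unity and partial fractions\<close>

text \<open>
  Multiplication by an \<open>N\<close>-th root of unity \<open>\<eta>\<close> permutes the index set and scales the sum by
  \<open>\<eta>\<^sup>k\<close>. A primitive \<open>\<eta>\<close> has \<open>\<eta>\<^sup>k \<noteq> 1\<close> for \<open>0 < k < N\<close>, which forces the sum to vanish.
\<close>

lemma sum_powers_of_nth_roots:
  fixes u :: complex
  assumes u: "u \<noteq> 0" and k: "k < N"
  shows "(\<Sum>\<theta> | \<theta> ^ N = u. \<theta> ^ k) = (if k = 0 then of_nat N else 0)"
proof (cases "k = 0")
  case True
  then show ?thesis using card_nth_roots[OF u, of N] k by simp
next
  case False
  define \<eta> where "\<eta> = cis (2 * pi / real N)"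
  have inj: "inj_on (\<lambda>k. cis (2 * pi * real k / real N)) {..<N}"
    using bij_betw_roots_unity[of N] k by (auto simp: bij_betw_def)
  have \<eta>k: "\<eta> ^ k = cis (2 * pi * real k / real N)"
    by (simp add: \<eta>_def DeMoivre mult_ac)
  have ne1: "\<eta> ^ k \<noteq> 1"
    using inj_onD[OF inj, of k 0] k False by (auto simp: \<eta>k)
  have \<eta>N: "\<eta> ^ N = 1"
    using k by (simp add: \<eta>_def DeMoivre)
  have \<eta>0: "\<eta> \<noteq> 0" by (simp add: \<eta>_def)
  have "(\<Sum>\<theta> | \<theta> ^ N = u. \<theta> ^ k) = (\<Sum>\<theta> | \<theta> ^ N = u. (\<eta> * \<theta>) ^ k)"
    by (rule sum.reindex_bij_witness[of _ "\<lambda>\<theta>. \<eta> * \<theta>" "\<lambda>\<theta>. \<theta> / \<eta>"])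
       (use \<eta>N \<eta>0 in \<open>auto simp: power_mult_distrib power_divide\<close>)
  also have "\<dots> = \<eta> ^ k * (\<Sum>\<theta> | \<theta> ^ N = u. \<theta> ^ k)"
    by (simp add: power_mult_distrib sum_distrib_left)
  finally show ?thesis using ne1 False by simp
qed

text \<open>
  The constant part, which is the value at infinity, is given explicitly as a coefficient of \<open>f\<close>: comparing it
  with the value at \<open>0\<close> is how the linear relation between the residues is found below. Poles are
  split off one at a time; the residue at \<open>p\<close> is the number \<open>c\<close> that makes \<open>f - c Q\<close> divisible by
  \<open>\<theta> - p\<close>, where \<open>Q\<close> is the product over the other poles.
\<close>

lemma partial_fractions_simple_poles:
  fixes f :: "'k::field poly"
  assumes "finite P" "degree f \<le> card P"
  shows "\<exists>c. \<forall>\<theta>. \<theta> \<notin> P \<longrightarrow>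
    poly f \<theta> / (\<Prod>p\<in>P. \<theta> - p) = coeff f (card P) + (\<Sum>p\<in>P. c p / (\<theta> - p))"
  using assms
proof (induction P arbitrary: f rule: finite_induct)
  case empty
  then obtain a where "f = [:a:]" by (auto elim: degree_eq_zeroE)
  then show ?case by simp
next
  case (insert p P)
  define Q where "Q = (\<Prod>z\<in>P. [:- z, 1:])"
  have Q: "poly Q \<theta> = (\<Prod>z\<in>P. \<theta> - z)" for \<theta>
    by (simp add: Q_def poly_prod)
  have degQ: "degree Q = card P"
    unfolding Q_def by (subst degree_prod_eq_sum_degree) auto
  have Qp: "poly Q p \<noteq> 0" using insert by (auto simp: Q)
  define c where "c = poly f p / poly Q p"
  have "poly (f - smult c Q) p = 0" using Qp by (simp add: c_def)
  then obtain g where g: "f - smult c Q = [:- p, 1:] * g"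
    by (metis dvdE poly_eq_0_iff_dvd)
  have "degree (f - smult c Q) \<le> Suc (card P)"
    using insert degQ by (intro degree_diff_le) auto
  then have degg: "degree g \<le> card P"
    by (cases "g = 0") (auto simp: g degree_mult_eq simp del: mult_pCons_left)
  obtain d where d: "\<forall>\<theta>. \<theta> \<notin> P \<longrightarrow>
      poly g \<theta> / (\<Prod>p\<in>P. \<theta> - p) = coeff g (card P) + (\<Sum>p\<in>P. d p / (\<theta> - p))"
    using insert.IH[OF degg] by blast
  have f: "f = smult c Q + [:- p, 1:] * g" using g by (simp add: algebra_simps)
  have lead: "coeff f (Suc (card P)) = coeff g (card P)"
    using degQ degg by (simp add: f coeff_eq_0)
  have "poly f \<theta> / (\<Prod>p\<in>insert p P. \<theta> - p) =
      coeff f (card (insert p P)) + (\<Sum>q\<in>insert p P. (d(p := c)) q / (\<theta> - q))"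
    if \<theta>: "\<theta> \<notin> insert p P" for \<theta>
  proof -
    have nz: "poly Q \<theta> \<noteq> 0" "\<theta> - p \<noteq> 0" using \<theta> insert by (auto simp: Q)
    have "poly f \<theta> / (\<Prod>p\<in>insert p P. \<theta> - p) = poly f \<theta> / ((\<theta> - p) * poly Q \<theta>)"
      using insert by (simp add: Q)
    also have "\<dots> = c / (\<theta> - p) + poly g \<theta> / poly Q \<theta>"
      using nz by (simp add: f field_simps)
    also have "poly g \<theta> / poly Q \<theta> = coeff g (card P) + (\<Sum>p\<in>P. d p / (\<theta> - p))"
      using d \<theta> by (simp add: Q)
    also have "(\<Sum>q\<in>P. d q / (\<theta> - q)) = (\<Sum>q\<in>P. (d(p := c)) q / (\<theta> - q))"
      using insert by (intro sum.cong) auto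
    finally show ?thesis using insert lead by simp
  qed
  then show ?case by blast
qed

text \<open>
  The order \<open>d\<close> of \<open>u\<close> is the modulus for which goodness of \<open>a\<close> is used on the coset \<open>\<theta>\<^sup>N = u\<close>.
\<close>

lemma root_of_unity_order:
  fixes u :: complex
  assumes u: "u ^ r = 1" and r: "r > 0"
  shows "\<exists>d>0. d dvd r \<and> (\<forall>n. u powi n = 1 \<longleftrightarrow> int d dvd n)"
proof -
  define d where "d = (LEAST d. d > 0 \<and> u ^ d = 1)"
  have d: "d > 0" "u ^ d = 1"
    using LeastI[of "\<lambda>d. d > 0 \<and> u ^ d = 1" r] u r by (auto simp: d_def)
  have least: "k = 0" if "u ^ k = 1" "k < d" for k
    using not_less_Least[of k "\<lambda>d. d > 0 \<and> u ^ d = 1"] that by (auto simp: d_def)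
  have u0: "u \<noteq> 0" using u r by (auto simp: power_0_left)
  have ord: "u powi n = 1 \<longleftrightarrow> int d dvd n" for n
  proof -
    define k where "k = nat (n mod int d)"
    have k: "int k = n mod int d" "k < d" using d by (auto simp: k_def nat_less_iff)
    have "u powi n = u powi (int d * (n div int d) + int k)" by (simp add: k)
    also have "\<dots> = u ^ k"
      using u0 d by (simp add: power_int_add power_int_mult)
    finally have "u powi n = 1 \<longleftrightarrow> k = 0" using least k(2) by auto
    also have "\<dots> \<longleftrightarrow> int d dvd n" using k(1) by (metis dvd_eq_mod_eq_0 of_nat_eq_0_iff)
    finally show ?thesis .
  qed
  have "d dvd r" using ord[of "int r"] u by simp
  with d ord show ?thesis by blast
qed

section \<open>Sums of products over a coset of the roots of unity\<close>

text \<open>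
  The argument takes place in a field containing the complex numbers and two nonzero elements
  \<open>x\<close>, \<open>y\<close>. That no positive power of \<open>x\<close> is \<open>1\<close> is all that the transcendence of \<open>x\<close> contributes:
  it separates the poles and keeps them off the roots of unity.
\<close>

locale hodge_field = field_hom \<iota> for \<iota> :: "complex \<Rightarrow> 'k::field" +
  fixes x y :: 'k
  assumes x_nonzero: "x \<noteq> 0" and y_nonzero: "y \<noteq> 0"
    and x_power_neq_1: "k > 0 \<Longrightarrow> x ^ k \<noteq> 1"
begin

text \<open>
  The contribution of a pair of inverse eigenvalues \<open>w\<close>, \<open>1/w\<close> to a term of the Hodge series.
\<close>

definition factor :: "complex \<Rightarrow> 'k" where
  "factor w = (1 + y * \<iota> w) * (1 + y * \<iota> (inverse w)) /
              ((1 - x * \<iota> w) * (1 - x * \<iota> (inverse w)))"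

lemma factor_inverse: "factor (inverse w) = factor w"
  by (simp add: factor_def mult_ac)

text \<open>
  Since \<open>u - p\<^sup>N = (\<theta> - p) \<cdot> \<Sum>\<^sub>k \<theta>\<^sup>k p\<^bsup>N-1-k\<^esup>\<close>, each summand is a polynomial in \<open>\<theta>\<close> of degree
  less than \<open>N\<close> over a common denominator, and summation over the roots leaves only its constant term.
  The result is written as \<open>1/p\<close> times a function of \<open>p\<^sup>N\<close>, because \<open>p\<^sup>N\<close> takes only two values on the
  poles that occur.
\<close>

lemma sum_inverse_over_nth_roots:
  assumes u: "u \<noteq> 0" and N: "N > 0" and p: "p \<noteq> 0" and pN: "p ^ N \<noteq> \<iota> u"
  shows "(\<Sum>\<theta> | \<theta> ^ N = u. 1 / (\<iota> \<theta> - p)) = of_nat N * p ^ N / (\<iota> u - p ^ N) / p"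
proof -
  obtain M where M: "N = Suc M" using N by (cases N) auto
  have term_eq: "1 / (\<iota> \<theta> - p) = (\<Sum>k<N. \<iota> (\<theta> ^ k) * p ^ (M - k)) / (\<iota> u - p ^ N)"
    if "\<theta> ^ N = u" for \<theta>
  proof -
    have "\<iota> u - p ^ N = (\<iota> \<theta> - p) * (\<Sum>k<N. \<iota> (\<theta> ^ k) * p ^ (M - k))"
      using diff_power_eq_sum[of "\<iota> \<theta>" M p] that by (auto simp: M hom_distribs)
    moreover have "\<iota> u - p ^ N \<noteq> 0" using pN by auto
    ultimately show ?thesis by (metis divide_self_if mult_eq_0_iff nonzero_divide_mult_cancel_right)
  qed
  have "(\<Sum>\<theta> | \<theta> ^ N = u. 1 / (\<iota> \<theta> - p)) =
      (\<Sum>\<theta> | \<theta> ^ N = u. (\<Sum>k<N. \<iota> (\<theta> ^ k) * p ^ (M - k)) / (\<iota> u - p ^ N))"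
    using term_eq by (intro sum.cong) auto
  also have "\<dots> = (\<Sum>k<N. \<Sum>\<theta> | \<theta> ^ N = u. \<iota> (\<theta> ^ k) * p ^ (M - k)) / (\<iota> u - p ^ N)"
    by (simp add: sum_divide_distrib[symmetric] sum.swap[of _ "{..<N}"])
  also have "(\<Sum>k<N. \<Sum>\<theta> | \<theta> ^ N = u. \<iota> (\<theta> ^ k) * p ^ (M - k)) =
      (\<Sum>k<N. \<iota> (\<Sum>\<theta> | \<theta> ^ N = u. \<theta> ^ k) * p ^ (M - k))"
    by (simp add: hom_sum sum_distrib_right)
  also have "\<dots> = (\<Sum>k<N. if k = 0 then of_nat N * p ^ M else 0)"
    by (intro sum.cong refl) (auto simp: sum_powers_of_nth_roots[OF u] hom_of_nat)
  also have "\<dots> = of_nat N * p ^ M" using N by simp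
  finally show ?thesis using p by (simp add: M)
qed

text \<open>
  The heart of the univalent case. That \<open>Z\<close> is a set, with no repeated factors, is what makes the poles
  of the summand simple; see the introduction for the computation. The hypothesis on \<open>u\<close>
  guarantees that no pole lies on the coset.
\<close>

lemma sum_factor_prod_inverse_coset:
  fixes Z :: "complex set"
  assumes finZ: "finite Z" and N: "N > 0" and Z: "\<And>z. z \<in> Z \<Longrightarrow> z ^ N = 1"
    and u: "u ^ M = 1" "M > 0"
  shows "(\<Sum>\<theta> | \<theta> ^ N = u. \<Prod>z\<in>Z. factor (\<theta> * z)) =
         (\<Sum>\<theta> | \<theta> ^ N = inverse u. \<Prod>z\<in>Z. factor (\<theta> * z))"
proof -
  have Z0: "z \<noteq> 0" if "z \<in> Z" for z using Z[OF that] N by (auto simp: power_0_left)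
  have \<iota>Z0: "\<iota> z \<noteq> 0" if "z \<in> Z" for z using Z0[OF that] by simp
  have \<iota>ZN: "\<iota> z ^ N = 1" if "z \<in> Z" for z
    using Z[OF that] by (metis hom_one hom_power)
  \<comment> \<open>\<open>P1\<close> and \<open>P2\<close> are the two kinds of poles; on them \<open>p\<^sup>N\<close> is \<open>X\<close> and \<open>1 / X\<close>.\<close>
  define X where "X = x ^ N"
  have X0: "X \<noteq> 0" using x_nonzero by (simp add: X_def)
  define P1 where "P1 = (\<lambda>z. x / \<iota> z) ` Z"
  define P2 where "P2 = (\<lambda>z. 1 / (x * \<iota> z)) ` Z"
  define P where "P = P1 \<union> P2"
  have fin: "finite P1" "finite P2" "finite P" using finZ by (auto simp: P1_def P2_def P_def)
  have inj1: "inj_on (\<lambda>z. x / \<iota> z) Z"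
    using x_nonzero \<iota>Z0 by (auto simp: inj_on_def field_simps)
  have inj2: "inj_on (\<lambda>z. 1 / (x * \<iota> z)) Z"
    using x_nonzero \<iota>Z0 by (auto simp: inj_on_def field_simps)
  have p1: "p ^ N = X" if "p \<in> P1" for p
    using that \<iota>ZN by (auto simp: P1_def X_def power_divide)
  have p2: "p ^ N = 1 / X" if "p \<in> P2" for p
    using that \<iota>ZN by (auto simp: P2_def X_def power_divide power_mult_distrib)
  have X_not_root: "X ^ k \<noteq> 1" if "k > 0" for k
    using x_power_neq_1[of "N * k"] N that by (simp add: X_def power_mult)
  have disj: "P1 \<inter> P2 = {}"
  proof -
    have "X \<noteq> 1 / X" using X_not_root[of 2] X0 by (auto simp: field_simps power2_eq_square)
    then show ?thesis using p1 p2 by force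
  qed
  have P0: "p \<noteq> 0" if "p \<in> P" for p
    using that x_nonzero \<iota>Z0 by (auto simp: P_def P1_def P2_def)
  \<comment> \<open>\<open>qf z\<close> is the numerator of \<open>factor (\<theta> * z)\<close>, scaled so that the denominator becomes the monic
      product \<open>(\<theta> - x / z) (\<theta> - 1 / (x z))\<close>.\<close>
  define qf where "qf z = [:- y / (x * \<iota> z ^ 2), - (1 + y\<^sup>2) / (x * \<iota> z), - y / x:]" for z
  define f where "f = (\<Prod>z\<in>Z. qf z)"
  have lead_qf: "degree (qf z) = 2" "lead_coeff (qf z) = - y / x" for z
    using x_nonzero y_nonzero by (auto simp: qf_def)
  have "qf z \<noteq> 0" for z using lead_qf(1)[of z] by auto
  then have "degree f = 2 * card Z"
    unfolding f_def by (subst degree_prod_eq_sum_degree) (auto simp: lead_qf)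
  moreover have cardP: "card P = 2 * card Z"
    using disj fin card_image[OF inj1] card_image[OF inj2]
    by (simp add: P_def P1_def P2_def card_Un_disjoint)
  ultimately have degf: "degree f = card P" by simp
  have lead_f: "coeff f (card P) = (\<Prod>z\<in>Z. - y / x)"
    unfolding degf[symmetric] f_def lead_coeff_prod by (simp only: lead_qf(2))
  obtain c where c: "\<And>\<theta>. \<theta> \<notin> P \<Longrightarrow>
      poly f \<theta> / (\<Prod>p\<in>P. \<theta> - p) = coeff f (card P) + (\<Sum>p\<in>P. c p / (\<theta> - p))"
    using partial_fractions_simple_poles[OF fin(3), of f] degf by auto
  have prodP: "(\<Prod>p\<in>P. \<theta> - p) = (\<Prod>z\<in>Z. (\<theta> - x / \<iota> z) * (\<theta> - 1 / (x * \<iota> z)))" for \<theta>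
    using disj fin unfolding P_def
    by (simp add: prod.union_disjoint P1_def P2_def prod.reindex[OF inj1] prod.reindex[OF inj2]
        prod.distrib)
  \<comment> \<open>The values at \<open>0\<close> and at infinity agree, so the weighted residues sum to zero.\<close>
  have "poly f 0 / (\<Prod>p\<in>P. 0 - p) = (\<Prod>z\<in>Z. - y / x)"
    unfolding f_def poly_prod prodP prod_dividef[symmetric]
    using x_nonzero \<iota>Z0 by (intro prod.cong refl) (auto simp: qf_def field_simps power2_eq_square)
  then have "(\<Sum>p\<in>P. c p / (0 - p)) = 0"
    using c[of 0] P0 lead_f by force
  then have c_sum: "(\<Sum>p\<in>P1. c p / p) + (\<Sum>p\<in>P2. c p / p) = 0"
    using disj fin by (simp add: P_def sum.union_disjoint sum_negf flip: sum.union_disjoint)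
  define S where "S = (\<Sum>p\<in>P1. c p / p)"
  define C where "C = (\<Prod>z\<in>Z. - y / x)"
  have S2: "(\<Sum>p\<in>P2. c p / p) = - S" using c_sum by (simp add: S_def add_eq_0_iff)
  have eval: "(\<Prod>z\<in>Z. factor (\<theta> * z)) = C + (\<Sum>p\<in>P. c p / (\<iota> \<theta> - p))"
    if \<theta>: "\<theta> \<noteq> 0" "\<iota> \<theta> \<notin> P" for \<theta>
  proof -
    have "factor (\<theta> * z) =
        poly (qf z) (\<iota> \<theta>) / ((\<iota> \<theta> - x / \<iota> z) * (\<iota> \<theta> - 1 / (x * \<iota> z)))" if z: "z \<in> Z" for z
    proof -
      have nz: "\<iota> \<theta> \<noteq> 0" "\<iota> z \<noteq> 0" using \<theta> \<iota>Z0 z by auto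
      have "\<iota> \<theta> \<noteq> x / \<iota> z" "\<iota> \<theta> \<noteq> 1 / (x * \<iota> z)"
        using \<theta> z by (auto simp: P_def P1_def P2_def)
      then have nz2: "\<iota> \<theta> * \<iota> z - x \<noteq> 0" "1 - x * \<iota> \<theta> * \<iota> z \<noteq> 0"
        using nz x_nonzero by (auto simp: field_simps)
      have 1: "factor (\<theta> * z) = (1 + y * (\<iota> \<theta> * \<iota> z)) * (\<iota> \<theta> * \<iota> z + y) / ((1 - x * \<iota> \<theta> * \<iota> z) * (\<iota> \<theta> * \<iota> z - x))"
        using nz nz2 by (simp add: factor_def hom_distribs divide_simps) (simp add: algebra_simps)
      have 2: "poly (qf z) (\<iota> \<theta>) = (1 + y * (\<iota> \<theta> * \<iota> z)) * (\<iota> \<theta> * \<iota> z + y) * (- 1 / (x * \<iota> z ^ 2))"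
        using nz x_nonzero by (simp add: qf_def field_simps power2_eq_square)
      have 3: "(\<iota> \<theta> - x / \<iota> z) * (\<iota> \<theta> - 1 / (x * \<iota> z)) =
          ((1 - x * \<iota> \<theta> * \<iota> z) * (\<iota> \<theta> * \<iota> z - x)) * (- 1 / (x * \<iota> z ^ 2))"
        using nz x_nonzero by (simp add: field_simps power2_eq_square)
      show ?thesis unfolding 1 2 3 using nz x_nonzero by simp
    qed
    then have "(\<Prod>z\<in>Z. factor (\<theta> * z)) = poly f (\<iota> \<theta>) / (\<Prod>p\<in>P. \<iota> \<theta> - p)"
      by (simp add: f_def poly_prod prodP prod_dividef prod.distrib)
    also have "\<dots> = C + (\<Sum>p\<in>P. c p / (\<iota> \<theta> - p))"
      using c \<theta> lead_f by (simp add: C_def)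
    finally show ?thesis .
  qed
  have total: "(\<Sum>\<theta> | \<theta> ^ N = v. \<Prod>z\<in>Z. factor (\<theta> * z)) =
      of_nat N * C + of_nat N * S * (X / (\<iota> v - X) - 1 / (\<iota> v * X - 1))"
    and v_nz: "\<iota> v \<noteq> X" "\<iota> v * X \<noteq> 1"
    if v: "v ^ M = 1" for v
  proof -
    have v0: "v \<noteq> 0" using v u(2) by (auto simp: power_0_left)
    have \<iota>v: "\<iota> v ^ M = 1" using v by (metis hom_one hom_power)
    show vX: "\<iota> v \<noteq> X" using \<iota>v X_not_root[OF u(2)] by auto
    show vX': "\<iota> v * X \<noteq> 1"
      using \<iota>v X_not_root[OF u(2)] by (metis mult_1 power_mult_distrib power_one)
    have notP: "p ^ N \<noteq> \<iota> v" if "p \<in> P" for p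
    proof (cases "p \<in> P1")
      case True
      then show ?thesis using p1 vX by metis
    next
      case False
      then have "p ^ N * X = 1" using that p2 X0 by (simp add: P_def)
      then show ?thesis using vX' by metis
    qed
    have "(\<Sum>\<theta> | \<theta> ^ N = v. \<Prod>z\<in>Z. factor (\<theta> * z)) =
        (\<Sum>\<theta> | \<theta> ^ N = v. C + (\<Sum>p\<in>P. c p / (\<iota> \<theta> - p)))"
    proof (intro sum.cong refl eval)
      fix \<theta> assume "\<theta> \<in> {\<theta>. \<theta> ^ N = v}"
      then have \<theta>: "\<theta> ^ N = v" by simp
      show "\<theta> \<noteq> 0" using \<theta> v0 N by (auto simp: power_0_left)
      show "\<iota> \<theta> \<notin> P" using notP[of "\<iota> \<theta>"] \<theta> by (auto simp: hom_power)
    qed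
    also have "\<dots> = of_nat N * C + (\<Sum>p\<in>P. \<Sum>\<theta> | \<theta> ^ N = v. c p / (\<iota> \<theta> - p))"
      using card_nth_roots[OF v0 N] by (simp add: sum.distrib sum.swap[of _ P])
    also have "(\<Sum>p\<in>P. \<Sum>\<theta> | \<theta> ^ N = v. c p / (\<iota> \<theta> - p)) =
        (\<Sum>p\<in>P. c p * (of_nat N * p ^ N / (\<iota> v - p ^ N) / p))"
    proof (intro sum.cong refl)
      fix p assume p: "p \<in> P"
      have "(\<Sum>\<theta> | \<theta> ^ N = v. c p / (\<iota> \<theta> - p)) = c p * (\<Sum>\<theta> | \<theta> ^ N = v. 1 / (\<iota> \<theta> - p))"
        by (simp add: sum_distrib_left)
      then show "(\<Sum>\<theta> | \<theta> ^ N = v. c p / (\<iota> \<theta> - p)) = c p * (of_nat N * p ^ N / (\<iota> v - p ^ N) / p)"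
        by (simp add: sum_inverse_over_nth_roots[OF v0 N P0[OF p] notP[OF p]])
    qed
    also have "\<dots> = (\<Sum>p\<in>P1. c p / p * (of_nat N * X / (\<iota> v - X))) +
        (\<Sum>p\<in>P2. c p / p * (of_nat N * (1 / X) / (\<iota> v - 1 / X)))"
      using disj fin by (simp add: P_def sum.union_disjoint p1 p2 mult_ac)
    also have "\<dots> = S * (of_nat N * X / (\<iota> v - X)) + (- S) * (of_nat N * (1 / X) / (\<iota> v - 1 / X))"
      unfolding S2[symmetric] by (simp only: S_def sum_distrib_right)
    also have "(1 / X) / (\<iota> v - 1 / X) = 1 / (\<iota> v * X - 1)"
      using X0 vX' by (simp add: field_simps)
    then have "of_nat N * (1 / X) / (\<iota> v - 1 / X) = of_nat N * (1 / (\<iota> v * X - 1))"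
      by (metis times_divide_eq_right)
    finally show "(\<Sum>\<theta> | \<theta> ^ N = v. \<Prod>z\<in>Z. factor (\<theta> * z)) =
      of_nat N * C + of_nat N * S * (X / (\<iota> v - X) - 1 / (\<iota> v * X - 1))"
      by (simp add: algebra_simps)
  qed
  have u0: "\<iota> u \<noteq> 0" using u by (auto simp: power_0_left)
  have iu: "inverse u ^ M = 1" using u by (simp add: power_inverse)
  have nz: "\<iota> u - X \<noteq> 0" "\<iota> u * X - 1 \<noteq> 0" using v_nz[OF u(1)] by auto
  \<comment> \<open>Inverting \<open>u\<close> interchanges the two fractions up to sign and a common constant, so their difference is invariant.\<close>
  have a: "X / (\<iota> (inverse u) - X) = - 1 - 1 / (\<iota> u * X - 1)"
    using u0 nz unfolding hom_inverse by (simp add: divide_simps) (simp add: algebra_simps)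
  have b: "1 / (\<iota> (inverse u) * X - 1) = - 1 - X / (\<iota> u - X)"
    using u0 nz unfolding hom_inverse by (simp add: divide_simps) (simp add: algebra_simps)
  have "X / (\<iota> (inverse u) - X) - 1 / (\<iota> (inverse u) * X - 1) =
      X / (\<iota> u - X) - 1 / (\<iota> u * X - 1)"
    unfolding a b by simp
  then show ?thesis by (simp only: total[OF u(1)] total[OF iu])
qed


text \<open>
  Since \<open>u\<^sup>c\<close> depends only on \<open>c\<close> modulo the order \<open>d\<close> of \<open>u\<close>, a single coset sees \<open>a\<close> only mod \<open>d\<close>. If
  \<open>a\<close> is univalent mod \<open>d\<close>, the powers \<open>u\<^sup>c\<close> are distinct and the partial fraction argument applies; if it is
  reversible mod \<open>d\<close>, a rotation of the coset carries one sum to the other.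
\<close>

lemma sum_over_coset_uminus:
  assumes r: "r > 0" "r dvd N" and N: "N > 0" and u: "u ^ r = 1"
    and a: "hereditarily_good a r"
  shows "(\<Sum>\<theta> | \<theta> ^ N = u. \<Prod>c\<leftarrow>a. factor (\<theta> * u powi (- c))) =
         (\<Sum>\<theta> | \<theta> ^ N = u. \<Prod>c\<leftarrow>a. factor (\<theta> * u powi c))"
proof -
  have u0: "u \<noteq> 0" using u r by (auto simp: power_0_left)
  obtain d where d: "d > 0" "d dvd r" and ord: "\<And>n. u powi n = 1 \<longleftrightarrow> int d dvd n"
    using root_of_unity_order[OF u r(1)] by blast
  have powi_eq: "u powi i = u powi j \<longleftrightarrow> i mod int d = j mod int d" for i j
  proof -
    have "u powi i = u powi j \<longleftrightarrow> u powi (i - j) = 1"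
      using u0 by (simp add: power_int_diff)
    then show ?thesis by (simp add: ord mod_eq_dvd_iff)
  qed
  have uN: "u ^ N = 1" using u r(2) by (auto simp: power_mult)
  have powi_N: "(u powi n) ^ N = 1" for n
    using uN by (metis power_int_mult power_int_of_nat mult.commute power_int_1_left)
  from a d have "univalent a d \<or> reversible a d"
    by (auto simp: hereditarily_good_def good_def)
  then show ?thesis
  proof
    assume "univalent a d"
    then have "distinct (map (\<lambda>c. c mod int d) a)" by (simp add: univalent_def)
    then have dist: "distinct (map (\<lambda>c. u powi c) a)"
      by (auto simp: distinct_map inj_on_def powi_eq)
    define Z where "Z = set (map (\<lambda>c. u powi c) a)"
    have prod_Z: "(\<Prod>c\<leftarrow>a. factor (\<theta> * u powi c)) = (\<Prod>z\<in>Z. factor (\<theta> * z))" for \<theta>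
      unfolding Z_def using prod.distinct_set_conv_list[OF dist, of "\<lambda>z. factor (\<theta> * z)"]
      by (simp add: o_def)
    have "(\<Sum>\<theta> | \<theta> ^ N = u. \<Prod>c\<leftarrow>a. factor (\<theta> * u powi (- c))) =
        (\<Sum>\<theta> | \<theta> ^ N = u. \<Prod>c\<leftarrow>a. factor (inverse \<theta> * u powi c))"
    proof (intro sum.cong refl arg_cong[of _ _ prod_list] map_cong)
      fix \<theta> c
      show "factor (\<theta> * u powi (- c)) = factor (inverse \<theta> * u powi c)"
        using factor_inverse[of "inverse \<theta> * u powi c"] by (simp add: power_int_minus)
    qed
    also have "\<dots> = (\<Sum>\<theta> | \<theta> ^ N = inverse u. \<Prod>c\<leftarrow>a. factor (\<theta> * u powi c))"
      by (rule sum.reindex_bij_witness[of _ inverse inverse]) (auto simp: power_inverse)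
    also have "\<dots> = (\<Sum>\<theta> | \<theta> ^ N = u. \<Prod>c\<leftarrow>a. factor (\<theta> * u powi c))"
      unfolding prod_Z
      by (rule sum_factor_prod_inverse_coset[symmetric, of _ _ _ r])
         (use N u r powi_N in \<open>auto simp: Z_def\<close>)
    finally show ?thesis .
  next
    assume "reversible a d"
    then obtain e where
      e: "mset (map (\<lambda>c. (c + e) mod int d) a) = mset (map (\<lambda>c. (- c) mod int d) a)"
      by (auto simp: reversible_def)
    have powi_mod: "u powi (n mod int d) = u powi n" for n by (simp add: powi_eq)
    have prod_eq: "(\<Prod>c\<leftarrow>a. factor (\<theta> * u powi (- c))) = (\<Prod>c\<leftarrow>a. factor (\<theta> * u powi e * u powi c))" for \<theta>
    proof -
      have "mset (map (\<lambda>c. factor (\<theta> * u powi ((- c) mod int d))) a) =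
          image_mset (\<lambda>n. factor (\<theta> * u powi n)) (mset (map (\<lambda>c. (- c) mod int d) a))"
        by (simp add: image_mset.compositionality o_def)
      also have "\<dots> = mset (map (\<lambda>c. factor (\<theta> * u powi ((c + e) mod int d))) a)"
        unfolding e[symmetric] by (simp add: image_mset.compositionality o_def)
      finally have "mset (map (\<lambda>c. factor (\<theta> * u powi (- c))) a) =
          mset (map (\<lambda>c. factor (\<theta> * u powi (c + e))) a)"
        unfolding powi_mod .
      then have "(\<Prod>c\<leftarrow>a. factor (\<theta> * u powi (- c))) = (\<Prod>c\<leftarrow>a. factor (\<theta> * u powi (c + e)))"
        by (metis prod_mset_prod_list)
      then show ?thesis using u0 by (simp add: power_int_add mult_ac)
    qed
    \<comment> \<open>Multiplication by \<open>u powi e\<close> preserves the coset because \<open>u\<close> is an \<open>N\<close>-th root of unity.\<close>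
    show ?thesis unfolding prod_eq
      by (rule sum.reindex_bij_witness[of _ "\<lambda>\<theta>. \<theta> / u powi e" "\<lambda>\<theta>. \<theta> * u powi e"])
         (use u0 in \<open>auto simp: power_mult_distrib power_divide powi_N\<close>)
  qed
qed

text \<open>
  The map \<open>\<theta> \<mapsto> \<theta>\<^sup>N\<close> fibres the roots of unity of order dividing \<open>N r\<close> over those of order dividing \<open>r\<close>, and the
  eigenvalue exponent \<open>N c + 1\<close> turns into \<open>\<theta> u\<^sup>c\<close> on the fibre of \<open>u\<close>.
\<close>

lemma sum_over_roots_uminus:
  assumes r: "r > 0" "r dvd N" and N: "N > 0" and a: "hereditarily_good a r"
  shows "(\<Sum>\<theta> | \<theta> ^ (N * r) = 1. \<Prod>c\<leftarrow>map uminus a. factor (\<theta> powi (int N * c + 1))) =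
         (\<Sum>\<theta> | \<theta> ^ (N * r) = 1. \<Prod>c\<leftarrow>a. factor (\<theta> powi (int N * c + 1)))"
proof -
  have split: "(\<Sum>\<theta> | \<theta> ^ (N * r) = 1. g \<theta>) = (\<Sum>u | u ^ r = 1. \<Sum>\<theta> | \<theta> ^ N = u. g \<theta>)"
    for g :: "complex \<Rightarrow> 'k"
  proof -
    have "(\<Sum>\<theta> | \<theta> ^ (N * r) = 1. g \<theta>) =
        (\<Sum>u | u ^ r = 1. sum g {\<theta> \<in> {\<theta>. \<theta> ^ (N * r) = 1}. \<theta> ^ N = u})"
      by (rule sum.group[symmetric]) (use r N finite_nth_roots[of "N * r" 1] finite_nth_roots[of r 1] in \<open>auto simp: power_mult\<close>)
    also have "\<dots> = (\<Sum>u | u ^ r = 1. \<Sum>\<theta> | \<theta> ^ N = u. g \<theta>)"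
      by (intro sum.cong refl) (auto simp: power_mult)
    finally show ?thesis .
  qed
  have eigenvalue: "\<theta> powi (int N * c + 1) = \<theta> * u powi c" if "\<theta> ^ N = u" "u ^ r = 1" for \<theta> u :: complex and c
  proof -
    have "\<theta> \<noteq> 0" using that r N by (auto simp: power_0_left)
    then show ?thesis using that(1) by (auto simp: power_int_add power_int_mult)
  qed
  have "(\<Sum>\<theta> | \<theta> ^ (N * r) = 1. \<Prod>c\<leftarrow>map uminus a. factor (\<theta> powi (int N * c + 1))) =
      (\<Sum>u | u ^ r = 1. \<Sum>\<theta> | \<theta> ^ N = u. \<Prod>c\<leftarrow>a. factor (\<theta> * u powi (- c)))"
    unfolding split map_map o_def
    by (intro sum.cong refl arg_cong[of _ _ prod_list] map_cong arg_cong[of _ _ factor] eigenvalue) auto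
  also have "\<dots> = (\<Sum>u | u ^ r = 1. \<Sum>\<theta> | \<theta> ^ N = u. \<Prod>c\<leftarrow>a. factor (\<theta> * u powi c))"
    by (intro sum.cong refl sum_over_coset_uminus[OF r N _ a]) auto
  also have "\<dots> = (\<Sum>\<theta> | \<theta> ^ (N * r) = 1. \<Prod>c\<leftarrow>a. factor (\<theta> powi (int N * c + 1)))"
    unfolding split
    by (intro sum.cong refl arg_cong[of _ _ prod_list] map_cong arg_cong[of _ _ factor] eigenvalue[symmetric]) auto
  finally show ?thesis .
qed

end

section \<open>Diagonal matrices and the groups \<open>L q s\<close>\<close>

lemma det_mat_diag: "det (mat_diag n f) = (\<Prod>i<n. f i)"
proof -
  have "det (mat_diag n f) = prod_list (diag_mat (mat_diag n f))"
    by (rule det_upper_triangular[of _ n]) (auto simp: mat_diag_def upper_triangular_def)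
  also have "diag_mat (mat_diag n f) = map f [0..<n]"
    by (auto simp: diag_mat_def mat_diag_def)
  finally show ?thesis
    by (simp add: prod.distinct_set_conv_list[symmetric] atLeast0LessThan)
qed

lemma mat_adjoint_mat_diag: "mat_adjoint (mat_diag n f) = mat_diag n (\<lambda>i. cnj (f i))"
  by (rule eq_matI) (auto simp: mat_adjoint_def mat_diag_def mat_of_rows_def)

text \<open>
  The inverse in a monoid is defined by a description operator; a two-sided inverse satisfies it uniquely by
  associativity of the matrix product.
\<close>

lemma unitary_group_inv:
  assumes "U \<in> carrier_mat n n" "V \<in> carrier (unitary_group n)" "V * U = 1\<^sub>m n" "U * V = 1\<^sub>m n"
  shows "inv\<^bsub>unitary_group n\<^esub> U = V"
  unfolding m_inv_def
proof (rule the_equality)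
  show "V \<in> carrier (unitary_group n) \<and> U \<otimes>\<^bsub>unitary_group n\<^esub> V = \<one>\<^bsub>unitary_group n\<^esub> \<and>
      V \<otimes>\<^bsub>unitary_group n\<^esub> U = \<one>\<^bsub>unitary_group n\<^esub>"
    using assms by (simp add: unitary_group_def)
next
  fix W
  assume "W \<in> carrier (unitary_group n) \<and> U \<otimes>\<^bsub>unitary_group n\<^esub> W = \<one>\<^bsub>unitary_group n\<^esub> \<and>
      W \<otimes>\<^bsub>unitary_group n\<^esub> U = \<one>\<^bsub>unitary_group n\<^esub>"
  then have W: "W \<in> carrier_mat n n" "U * W = 1\<^sub>m n" by (auto simp: unitary_group_def)
  have V: "V \<in> carrier_mat n n" using assms by (simp add: unitary_group_def)
  have "W = V * U * W" using W assms by simp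
  also have "\<dots> = V * (U * W)" using W V assms by (metis assoc_mult_mat)
  also have "\<dots> = V" using W V by simp
  finally show "W = V" .
qed

text \<open>
  Indexing \<open>L q s\<close> by the root of unity \<open>\<theta>\<close> itself, instead of by its exponent, is what allows the
  Hodge series to be reindexed by multiplication and inversion of \<open>\<theta>\<close>.
\<close>

definition diag_powers :: "int list \<Rightarrow> complex \<Rightarrow> complex mat" where
  "diag_powers s \<theta> = mat_diag (length s) (\<lambda>i. \<theta> powi (s ! i))"

lemma L_eq_image_roots:
  assumes q: "q > 0"
  shows "L q s = diag_powers s ` {\<theta>. \<theta> ^ q = 1}"
proof -
  have root: "root_of_unity q ^ k = cis (2 * pi * real k / real q)" for k
    by (simp add: root_of_unity_def cis_conv_exp flip: exp_of_nat_mult) (simp add: mult_ac)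
  have "{\<theta>. \<theta> ^ q = 1} = (\<lambda>k. root_of_unity q ^ k) ` {0..<q}"
    using bij_betw_imp_surj_on[OF bij_betw_roots_unity[OF q]]
    by (simp add: root atLeast0LessThan)
  then show ?thesis
    by (simp add: L_def diag_powers_def image_image power_int_mult)
qed

lemma diag_powers_mult:
  "diag_powers s \<theta> * diag_powers s \<eta> = diag_powers s (\<theta> * \<eta>)"
  by (simp add: diag_powers_def power_int_mult_distrib)

lemma diag_powers_1: "diag_powers s 1 = 1\<^sub>m (length s)"
  by (simp add: diag_powers_def)

lemma diag_powers_unitary:
  assumes "\<theta> ^ q = 1" "q > 0"
  shows "diag_powers s \<theta> \<in> carrier (unitary_group (length s))"
proof -
  have "norm \<theta> = 1" using assms power_eq_1_iff by blast
  then have "norm (\<theta> powi n) = 1" for n by (simp add: norm_power_int)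
  then have "cnj (\<theta> powi n) * \<theta> powi n = 1" for n
    using complex_norm_square[of "\<theta> powi n"] by (simp add: mult.commute)
  then show ?thesis
    by (simp add: unitary_group_def diag_powers_def mat_adjoint_mat_diag)
qed

lemma subgroup_L:
  assumes q: "q > 0"
  shows "subgroup (L q s) (unitary_group (length s))"
proof
  show "L q s \<subseteq> carrier (unitary_group (length s))"
    using diag_powers_unitary q by (auto simp: L_eq_image_roots)
next
  fix U V assume "U \<in> L q s" "V \<in> L q s"
  then obtain \<theta> \<eta> where "\<theta> ^ q = 1" "\<eta> ^ q = 1" "U = diag_powers s \<theta>" "V = diag_powers s \<eta>"
    using q by (auto simp: L_eq_image_roots)
  then show "U \<otimes>\<^bsub>unitary_group (length s)\<^esub> V \<in> L q s"
    using q by (auto simp: L_eq_image_roots unitary_group_def diag_powers_mult power_mult_distrib)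
next
  show "\<one>\<^bsub>unitary_group (length s)\<^esub> \<in> L q s"
    using q by (auto simp: L_eq_image_roots unitary_group_def diag_powers_1[symmetric])
next
  fix U assume "U \<in> L q s"
  then obtain \<theta> where \<theta>: "\<theta> ^ q = 1" "U = diag_powers s \<theta>"
    using q by (auto simp: L_eq_image_roots)
  have \<theta>0: "\<theta> \<noteq> 0" using \<theta> q by (auto simp: power_0_left)
  have i: "inverse \<theta> ^ q = 1" using \<theta> by (simp add: power_inverse)
  have "inv\<^bsub>unitary_group (length s)\<^esub> U = diag_powers s (inverse \<theta>)"
    using \<theta>0 diag_powers_unitary[OF i q]
    by (intro unitary_group_inv)
       (auto simp: \<theta>(2) diag_powers_mult diag_powers_1, simp add: diag_powers_def)
  then show "inv\<^bsub>unitary_group (length s)\<^esub> U \<in> L q s"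
    using i q by (auto simp: L_eq_image_roots)
qed

section \<open>The Hodge series of \<open>LMR r t a\<close>\<close>

abbreviation const_fract :: "complex \<Rightarrow> complex poly poly fract" where
  "const_fract c \<equiv> to_fract [:[:c:]:]"

lemma to_fract_prod: "to_fract (\<Prod>i\<in>A. f i) = (\<Prod>i\<in>A. to_fract (f i))"
  by (induction A rule: infinite_finite_induct) auto

lemma hodge_term_diag_powers:
  "to_fract (det (1\<^sub>m (length s) + var_y \<cdot>\<^sub>m const_mat (diag_powers s \<theta>))) /
   to_fract (det (1\<^sub>m (length s) - var_x \<cdot>\<^sub>m const_mat (diag_powers s \<theta>))) =
   (\<Prod>n\<leftarrow>s. (1 + to_fract var_y * const_fract (\<theta> powi n)) / (1 - to_fract var_x * const_fract (\<theta> powi n)))"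
proof -
  let ?c = "\<lambda>i. [:[:\<theta> powi (s ! i):]:]"
  have "1\<^sub>m (length s) + var_y \<cdot>\<^sub>m const_mat (diag_powers s \<theta>) = mat_diag (length s) (\<lambda>i. 1 + var_y * ?c i)"
    by (rule eq_matI) (auto simp: const_mat_def diag_powers_def mat_diag_def)
  moreover have "1\<^sub>m (length s) - var_x \<cdot>\<^sub>m const_mat (diag_powers s \<theta>) = mat_diag (length s) (\<lambda>i. 1 - var_x * ?c i)"
    by (rule eq_matI) (auto simp: const_mat_def diag_powers_def mat_diag_def)
  moreover have "(\<Prod>n\<leftarrow>s. g n) = (\<Prod>i<length s. g (s ! i))" for g :: "int \<Rightarrow> complex poly poly fract"
    by (simp add: prod.list_conv_set_nth atLeast0LessThan)
  ultimately show ?thesis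
    by (simp only: det_mat_diag to_fract_prod prod_dividef to_fract_add to_fract_diff to_fract_mult to_fract_1)
qed

text \<open>
  The Hodge series sums over distinct matrices; injectivity of the parametrisation turns this into a sum
  over all \<open>q\<close>-th roots of unity without multiplicities.
\<close>

lemma hodge_series_L:
  assumes q: "q > 0" and inj: "inj_on (diag_powers s) {\<theta>. \<theta> ^ q = 1}"
  shows "hodge_series (length s) (L q s) =
    1 / of_nat q * (\<Sum>\<theta> | \<theta> ^ q = 1.
      \<Prod>n\<leftarrow>s. (1 + to_fract var_y * const_fract (\<theta> powi n)) / (1 - to_fract var_x * const_fract (\<theta> powi n)))"
proof -
  have "card (L q s) = q"
    unfolding L_eq_image_roots[OF q] by (simp add: card_image[OF inj] card_roots_unity_eq q)
  then show ?thesis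
    unfolding hodge_series_def by (simp add: L_eq_image_roots[OF q] sum.reindex[OF inj] hodge_term_diag_powers)
qed

definition LMR_exponents :: "nat \<Rightarrow> int list \<Rightarrow> int list" where
  "LMR_exponents N a = concat (map (\<lambda>c. [int N * c + 1, - (int N * c + 1)]) a)"

lemma LMR_eq_L: "LMR r t a = L (r * t * r) (LMR_exponents (r * t) a)"
  by (simp add: LMR_def LMR_exponents_def power2_eq_square mult_ac)

lemma length_LMR_exponents: "length (LMR_exponents N a) = 2 * length a"
  by (induction a) (auto simp: LMR_exponents_def)

text \<open>
  The first diagonal entry \<open>\<theta>\<^bsup>Nc+1\<^esup>\<close> already determines \<open>\<theta>\<close>: the exponent \<open>Nc + 1\<close> is invertible modulo
  \<open>N r\<close> with inverse \<open>1 - Nc\<close>, because \<open>N r\<close> divides \<open>N\<^sup>2\<close>.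
\<close>

lemma inj_on_diag_powers_LMR:
  assumes "a \<noteq> []" "r > 0" "r dvd N" "N > 0"
  shows "inj_on (diag_powers (LMR_exponents N a)) {\<theta>. \<theta> ^ (N * r) = 1}"
proof (rule inj_onI)
  fix \<theta> \<eta> :: complex
  assume \<theta>: "\<theta> \<in> {\<theta>. \<theta> ^ (N * r) = 1}" and \<eta>: "\<eta> \<in> {\<theta>. \<theta> ^ (N * r) = 1}"
    and eq: "diag_powers (LMR_exponents N a) \<theta> = diag_powers (LMR_exponents N a) \<eta>"
  obtain c b where a: "a = c # b" using assms by (cases a) auto
  let ?n = "int N * c"
  have "diag_powers (LMR_exponents N a) \<zeta> $$ (0, 0) = \<zeta> powi (?n + 1)" for \<zeta>
    by (simp add: diag_powers_def mat_diag_def LMR_exponents_def a)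
  then have eq1: "\<theta> powi (?n + 1) = \<eta> powi (?n + 1)" using eq by metis
  have recover: "\<zeta> = (\<zeta> powi (?n + 1)) powi (1 - ?n)" if "\<zeta> ^ (N * r) = 1" for \<zeta> :: complex
  proof -
    have \<zeta>0: "\<zeta> \<noteq> 0" using that assms by (auto simp: power_0_left)
    obtain k where "N = r * k" using assms by auto
    then have "(?n + 1) * (1 - ?n) = 1 + int (N * r) * (- (int k * c * c))"
      by (simp add: algebra_simps)
    then have "(\<zeta> powi (?n + 1)) powi (1 - ?n) = \<zeta> powi (1 + int (N * r) * (- (int k * c * c)))"
      by (metis power_int_mult)
    also have "\<dots> = \<zeta> * (\<zeta> powi int (N * r)) powi (- (int k * c * c))"
      using \<zeta>0 by (simp only: power_int_add power_int_mult power_int_1_right simp_thms)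
    also have "\<dots> = \<zeta>" using that by (simp only: power_int_of_nat) simp
    finally show ?thesis by simp
  qed
  show "\<theta> = \<eta>" using recover[of \<theta>] recover[of \<eta>] \<theta> \<eta> eq1 by simp
qed


text \<open>
  Evaluation at \<open>x = 0\<close> separates \<open>x\<^sup>k\<close> from \<open>1\<close>.
\<close>

lemma var_x_power_neq_1: "k > 0 \<Longrightarrow> to_fract var_x ^ k \<noteq> 1"
proof
  assume k: "k > 0" and "to_fract var_x ^ k = 1"
  moreover have "to_fract var_x ^ k = to_fract (var_x ^ k)" by (induction k) auto
  ultimately have "var_x ^ k = 1" by (metis to_fract_1 to_fract_eq_iff)
  then have "poly (poly (var_x ^ k) 0) 0 = poly (poly 1 0) (0 :: complex)" by simp
  then show False using k by (simp add: var_x_def poly_power power_0_left)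
qed

interpretation fract: hodge_field const_fract "to_fract var_x" "to_fract var_y"
proof
  show "to_fract var_x ^ k \<noteq> 1" if "k > 0" for k using var_x_power_neq_1 that .
  show "const_fract (c + d) = const_fract c + const_fract d" for c d
    unfolding to_fract_add[symmetric] by simp
  show "const_fract (c * d) = const_fract c * const_fract d" for c d
    unfolding to_fract_mult[symmetric] by simp
  show "const_fract 1 = 1"
    unfolding to_fract_1[symmetric] by (simp add: one_pCons)
qed (auto simp: var_x_def var_y_def)

lemma LMR_term_eq_prod_factor:
  assumes "\<theta> \<noteq> 0"
  shows "(\<Prod>n\<leftarrow>LMR_exponents N a.
      (1 + to_fract var_y * const_fract (\<theta> powi n)) / (1 - to_fract var_x * const_fract (\<theta> powi n))) =
    (\<Prod>c\<leftarrow>a. fract.factor (\<theta> powi (int N * c + 1)))"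
proof (induction a)
  case Nil
  then show ?case by (simp add: LMR_exponents_def)
next
  case (Cons c a)
  have neg: "\<theta> powi (- (int N * c + 1)) = inverse (\<theta> powi (int N * c + 1))"
    by (rule power_int_minus)
  have exps: "LMR_exponents N (c # a) = [int N * c + 1, - (int N * c + 1)] @ LMR_exponents N a"
    by (simp add: LMR_exponents_def)
  show ?case
    unfolding exps by (simp del: minus_add_distrib add: Cons.IH neg fract.factor_def)
qed

lemma hodge_series_LMR:
  assumes a: "a \<noteq> []" and r: "r > 0" and t: "t > 0"
  shows "hodge_series (2 * length a) (LMR r t a) =
    1 / of_nat (r * t * r) *
      (\<Sum>\<theta> | \<theta> ^ (r * t * r) = 1. \<Prod>c\<leftarrow>a. fract.factor (\<theta> powi (int (r * t) * c + 1)))"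
proof -
  have q: "r * t * r > 0" using r t by simp
  have inj: "inj_on (diag_powers (LMR_exponents (r * t) a)) {\<theta>. \<theta> ^ (r * t * r) = 1}"
    by (rule inj_on_diag_powers_LMR) (use a r t in auto)
  show ?thesis
    unfolding LMR_eq_L length_LMR_exponents[of "r * t", symmetric] hodge_series_L[OF q inj]
    by (intro arg_cong2[of _ _ _ _ "(*)"] sum.cong refl LMR_term_eq_prod_factor)
       (use q in \<open>auto simp: power_0_left\<close>)
qed

theorem theorem1:
  fixes m r :: nat and a :: "int list"
  assumes "m \<ge> 1" and "r > 2" and "length a = m"
    and "hereditarily_good a r"
  shows "\<forall>t::nat. t \<ge> 1 \<longrightarrow> hodge_equivalent (2 * m) (LMR r t a) (LMR r t (map uminus a))"
proof (intro allI impI)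
  fix t :: nat assume t: "t \<ge> 1"
  have q: "r * t * r > 0" using assms t by simp
  have group: "finite (LMR r t b) \<and> subgroup (LMR r t b) (unitary_group (2 * m))"
    if "length b = m" for b
    using subgroup_L[OF q, of "LMR_exponents (r * t) b"] that
    by (simp add: LMR_eq_L L_def length_LMR_exponents)
  have ne: "a \<noteq> []" using assms by auto
  have "hodge_series (2 * m) (LMR r t (map uminus a)) = hodge_series (2 * m) (LMR r t a)"
    using hodge_series_LMR[of a r t] hodge_series_LMR[of "map uminus a" r t]
      fract.sum_over_roots_uminus[of r "r * t" a] assms t ne
    by simp
  then show "hodge_equivalent (2 * m) (LMR r t a) (LMR r t (map uminus a))"
    using group[of a] group[of "map uminus a"] assms by (simp add: hodge_equivalent_def)
qed

end
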